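(* Let $\{X_t\}_{t\in\mathbb{Z}}$ be a FIEGARCH$(p,d,q)$ process. If $d<0.5$, then $\{\ln(\sigma_t^2)\}_{t\in\mathbb{Z}}$ is weakly and strictly stationary and ergodic, and the random variable $\ln(\sigma_t^2)$ is almost surely finite for every $t\in\mathbb{Z}$. Moreover, $\{X_t\}_{t\in\mathbb{Z}}$ and $\{\sigma_t^2\}_{t\in\mathbb{Z}}$ are strictly stationary and ergodic processes.
   Context: FIEGARCH$(p,d,q)$: let $\{Z_t\}_{t\in\mathbb{Z}}$ be i.i.d. real random variables with mean $0$ and variance $1$; let $d,\omega,\theta,\gamma\in\mathbb{R}$; let $\alpha(z)=1-\sum_{i=1}^p\alpha_iz^i$, $\beta(z)=1-\sum_{j=1}^q\beta_jz^j$ be real polynomials with no common roots and $\beta(z)\neq0$ for $|z|\le1$. Let $\lambda_{d,k}$ be defined by $\frac{\alpha(z)}{\beta(z)}(1-z)^{-d}=\sum_{k=0}^\infty\lambda_{d,k}z^k$ for $|z|<1$, and put $g(Z_t)=\theta Z_t+\gamma\,[\,|Z_t|-\mathbb{E}(|Z_t|)\,]$. Then $X_t=\sigma_tZ_t$ with $\sigma_t>0$ given by $$\ln(\sigma_t^2)=\omega+\sum_{k=0}^\infty\lambda_{d,k}\,g(Z_{t-1-k}),\qquad t\in\mathbb{Z},$$ where the series is understood as the almost sure limit of its partial sums (almost sure finiteness of $\ln(\sigma_t^2)$ means that this series converges almost surely to a finite limit). *)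

theory Defs
  imports "HOL-Probability.Probability"
begin

definition covariance :: "'a measure \<Rightarrow> ('a \<Rightarrow> real) \<Rightarrow> ('a \<Rightarrow> real) \<Rightarrow> real" where
  "covariance M V W = (LINT x|M. (V x - (LINT y|M. V y)) * (W x - (LINT y|M. W y)))"

definition weakly_stationary :: "'a measure \<Rightarrow> (int \<Rightarrow> 'a \<Rightarrow> real) \<Rightarrow> bool" where
  "weakly_stationary M Y \<longleftrightarrow>
     (\<forall>t. Y t \<in> borel_measurable M \<and> integrable M (\<lambda>x. (Y t x)\<^sup>2)) \<and>
     (\<forall>s t. (LINT x|M. Y s x) = (LINT x|M. Y t x)) \<and>
     (\<forall>s t h. covariance M (Y (s + h)) (Y (t + h)) = covariance M (Y s) (Y t))"

text \<open>All finite-dimensional distributions are invariant under time shifts.\<close>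

definition strictly_stationary :: "'a measure \<Rightarrow> (int \<Rightarrow> 'a \<Rightarrow> real) \<Rightarrow> bool" where
  "strictly_stationary M Y \<longleftrightarrow>
     (\<forall>t. Y t \<in> borel_measurable M) \<and>
     (\<forall>J h. finite J \<longrightarrow>
        distr M (Pi\<^sub>M J (\<lambda>_. borel)) (\<lambda>x. \<lambda>t\<in>J. Y (t + h) x) =
        distr M (Pi\<^sub>M J (\<lambda>_. borel)) (\<lambda>x. \<lambda>t\<in>J. Y t x))"

text \<open>Every shift-invariant Borel set of paths has probability 0 or 1 under the law of the
  process. Stationarity is not part of this predicate and is asserted separately.\<close>

definition ergodic_process :: "'a measure \<Rightarrow> (int \<Rightarrow> 'a \<Rightarrow> real) \<Rightarrow> bool" where
  "ergodic_process M Y \<longleftrightarrow>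
     (\<forall>t. Y t \<in> borel_measurable M) \<and>
     (\<forall>A \<in> sets (Pi\<^sub>M UNIV (\<lambda>_. borel)). (\<lambda>y t. y (t + 1)) -` A = A \<longrightarrow>
        measure M {x \<in> space M. (\<lambda>t. Y t x) \<in> A} \<in> {0, 1})"

definition lag_poly :: "nat \<Rightarrow> (nat \<Rightarrow> real) \<Rightarrow> complex \<Rightarrow> complex" where
  "lag_poly n c z = 1 - (\<Sum>i = 1..n. of_real (c i) * z ^ i)"

definition news_impact :: "'a measure \<Rightarrow> real \<Rightarrow> real \<Rightarrow> ('a \<Rightarrow> real) \<Rightarrow> 'a \<Rightarrow> real" where
  "news_impact M \<theta> \<gamma> W x = \<theta> * W x + \<gamma> * (\<bar>W x\<bar> - (LINT y|M. \<bar>W y\<bar>))"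

text \<open>
  The coefficients \<open>lam\<close> are determined uniquely by \<open>lam_expansion\<close>; on the unit disc the real
  part of \<open>1 - z\<close> is positive, so the principal branch of the power is the analytic one.

  Convergence of the series for the log-volatility is not assumed: \<open>log_volatility\<close> fixes the
  value of \<open>ln (\<sigma>\<^sub>t\<^sup>2)\<close> at almost every point where the partial sums converge, and
  says nothing elsewhere. Hence measurability of \<open>\<sigma>\<close> is required explicitly.
\<close>

locale fiegarch = prob_space M
  for M :: "'a measure" +
  fixes p q :: nat
    and \<alpha> \<beta> :: "nat \<Rightarrow> real"
    and d \<omega> \<theta> \<gamma> :: real
    and lam :: "nat \<Rightarrow> real"
    and Z \<sigma> X :: "int \<Rightarrow> 'a \<Rightarrow> real"
  assumes Z_indep: "indep_vars (\<lambda>_. borel) Z UNIV"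
    and Z_ident: "\<And>s t. distr M borel (Z s) = distr M borel (Z t)"
    and Z_square_integrable: "\<And>t. integrable M (\<lambda>x. (Z t x)\<^sup>2)"
    and Z_mean: "\<And>t. expectation (Z t) = 0"
    and Z_variance: "\<And>t. variance (Z t) = 1"
    and no_common_roots: "\<And>z. \<not> (lag_poly p \<alpha> z = 0 \<and> lag_poly q \<beta> z = 0)"
    and \<beta>_nonzero: "\<And>z. norm z \<le> 1 \<Longrightarrow> lag_poly q \<beta> z \<noteq> 0"
    and lam_expansion: "\<And>z. norm z < 1 \<Longrightarrow>
      (\<lambda>k. of_real (lam k) * z ^ k) sums
        (lag_poly p \<alpha> z / lag_poly q \<beta> z * (1 - z) powr (- of_real d))"
    and \<sigma>_measurable: "\<And>t. random_variable borel (\<sigma> t)"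
    and \<sigma>_pos: "\<And>t x. x \<in> space M \<Longrightarrow> \<sigma> t x > 0"
    and log_volatility: "\<And>t. AE x in M.
      summable (\<lambda>k. lam k * news_impact M \<theta> \<gamma> (Z (t - 1 - int k)) x) \<longrightarrow>
      ln ((\<sigma> t x)\<^sup>2) = \<omega> + (\<Sum>k. lam k * news_impact M \<theta> \<gamma> (Z (t - 1 - int k)) x)"
    and X_eq: "\<And>t x. x \<in> space M \<Longrightarrow> X t x = \<sigma> t x * Z t x"

end

theory Submission
  imports Defs "HOL-Complex_Analysis.Complex_Analysis"
begin

text \<open>
  The quotient of the lag polynomials is analytic on a disc of radius larger than 1, so its
  coefficients are absolutely summable, while those of \<open>(1 - z) powr (- d)\<close> have order
  \<open>k powr (d - 1)\<close> and are square summable for \<open>d < 1 / 2\<close>. The convolution \<open>lam\<close> is therefore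
  square summable, and the series of independent centred terms defining the log-volatility
  converges almost surely and in \<open>L\<^sup>2\<close>. Each of the three processes is thus, up to null sets, a
  shift-equivariant measurable coding of the i.i.d. sequence \<open>Z\<close>, so it inherits stationarity and
  ergodicity from the Bernoulli shift.
\<close>

section \<open>Square summability of the coefficients\<close>

text \<open>For 0 < d < 1/2 the coefficients \<open>lam\<close> decay so slowly that they are in
  general not absolutely summable. Only the variances of the terms can be summed, and pointwise
  convergence has to be extracted from independence. This comes before everything probabilistic: the
  model ties \<open>\<sigma>\<close> to \<open>Z\<close> only where the series converges, so until
  convergence is known the three processes are not functions of \<open>Z\<close> at all. Ergodicity
  concerns two-sided paths. An invariant event may involve past and future coordinates alike and is
  not presented as a tail event, so asymptotic independence under the shift does the work of a
  zero-one law. It is established on the canonical product space, where the shift is an actual map,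
  and carried back to \<open>M\<close> through the law of \<open>Z\<close>. No moments of
  \<open>X\<close> or \<open>\<sigma>\<close> enter there; second moments matter only for weak
  stationarity of the log-volatility.\<close>

lemma summable_square_gbinomial:
  fixes d :: real
  assumes "d < 1 / 2"
  shows "summable (\<lambda>n. ((- d) gchoose n)\<^sup>2)"
proof -
  have "(\<lambda>n. (- d gchoose n) / ((-1) ^ n / exp ((- d + 1) * ln (real n))))
      \<longlonglongrightarrow> inverse (Gamma d)"
    using gbinomial_asymptotic[of "- d"] by simp
  \<comment> \<open>Only an upper bound is extracted, so the limit may be 0. This covers the poles
    of Gamma at d = 0, -1, -2, ..., where the binomial coefficients eventually vanish.\<close>
  then have "(\<lambda>n. (- d gchoose n)) \<in> O(\<lambda>n. (-1) ^ n / exp ((- d + 1) * ln (real n)))"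
    by (rule bigoI_tendsto) simp
  then have "(\<lambda>n. (- d gchoose n)\<^sup>2) \<in> O(\<lambda>n. ((-1) ^ n / exp ((- d + 1) * ln (real n)))\<^sup>2)"
    by (rule landau_o.big_power)
  moreover have "summable (\<lambda>n. norm (((-1) ^ n / exp ((- d + 1) * ln (real n)))\<^sup>2))"
  proof (rule summable_cong[THEN iffD1])
    \<comment> \<open>The exponent is below -1 exactly when d < 1/2; this is where the threshold
      arises.\<close>
    show "summable (\<lambda>n. real n powr (2 * d - 2))"
      using assms by (simp add: summable_real_powr_iff)
    \<comment> \<open>Index 0 must be excluded: \<open>0 powr _\<close> is 0, while the right-hand
      side is positive.\<close>
    show "\<forall>\<^sub>F n in sequentially.
        real n powr (2 * d - 2) = norm (((-1) ^ n / exp ((- d + 1) * ln (real n)))\<^sup>2)"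
      using eventually_gt_at_top[of 0]
      by eventually_elim
        (simp add: powr_def power_divide exp_double[symmetric] exp_minus[symmetric]
          divide_inverse algebra_simps flip: power_mult)
  qed
  ultimately show ?thesis
    by (rule summable_comparison_test_bigo[rotated])
qed

text \<open>Young's inequality for the convolution of an l^1 and an l^2 sequence. Cauchy-Schwarz
  with weights |a i| bounds each squared term by a constant times a Cauchy product of two summable
  nonnegative sequences.\<close>

lemma summable_square_convolution:
  fixes a b :: "nat \<Rightarrow> real"
  assumes a: "summable (\<lambda>k. \<bar>a k\<bar>)" and b: "summable (\<lambda>k. (b k)\<^sup>2)"
  shows "summable (\<lambda>k. (\<Sum>i\<le>k. a i * b (k - i))\<^sup>2)"
proof (rule summable_comparison_test')
  have "summable (\<lambda>k. \<Sum>i\<le>k. \<bar>a i\<bar> * (b (k - i))\<^sup>2)"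
    using Cauchy_product_sums[of "\<lambda>k. \<bar>a k\<bar>" "\<lambda>k. (b k)\<^sup>2"] a b by (simp add: sums_iff)
  then show "summable (\<lambda>k. (\<Sum>i. \<bar>a i\<bar>) * (\<Sum>i\<le>k. \<bar>a i\<bar> * (b (k - i))\<^sup>2))"
    by (rule summable_mult)
next
  fix k :: nat
  have "(\<Sum>i\<le>k. a i * b (k - i))\<^sup>2 \<le> (\<Sum>i\<le>k. \<bar>a i\<bar> * \<bar>b (k - i)\<bar>)\<^sup>2"
    by (rule abs_le_square_iff[THEN iffD1])
      (auto intro!: order_trans[OF sum_abs] order_trans[OF _ abs_ge_self] simp: abs_mult)
  \<comment> \<open>Splitting the weight into two square roots leaves one factor |a i| in each of
    the two Cauchy-Schwarz sums.\<close>
  also have "\<dots> = (\<Sum>i\<le>k. sqrt \<bar>a i\<bar> * (sqrt \<bar>a i\<bar> * \<bar>b (k - i)\<bar>))\<^sup>2"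
    by (simp flip: mult.assoc real_sqrt_mult)
  also have "\<dots> \<le> (\<Sum>i\<le>k. (sqrt \<bar>a i\<bar>)\<^sup>2) * (\<Sum>i\<le>k. (sqrt \<bar>a i\<bar> * \<bar>b (k - i)\<bar>)\<^sup>2)"
    by (rule Cauchy_Schwarz_ineq_sum)
  also have "\<dots> = (\<Sum>i\<le>k. \<bar>a i\<bar>) * (\<Sum>i\<le>k. \<bar>a i\<bar> * (b (k - i))\<^sup>2)"
    by (simp add: power_mult_distrib)
  also have "\<dots> \<le> (\<Sum>i. \<bar>a i\<bar>) * (\<Sum>i\<le>k. \<bar>a i\<bar> * (b (k - i))\<^sup>2)"
    using a by (intro mult_right_mono sum_le_suminf sum_nonneg) auto
  finally show "norm ((\<Sum>i\<le>k. a i * b (k - i))\<^sup>2)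
      \<le> (\<Sum>i. \<bar>a i\<bar>) * (\<Sum>i\<le>k. \<bar>a i\<bar> * (b (k - i))\<^sup>2)"
    by simp
qed

lemma holomorphic_lag_poly [holomorphic_intros]: "lag_poly n c holomorphic_on S"
  unfolding lag_poly_def by (intro holomorphic_intros)

text \<open>The zero-free set of the denominator is open and contains the compact closed disc, hence
  also a slightly larger disc. A power series converging beyond radius 1 converges absolutely at
  1.\<close>

lemma lag_poly_ratio_expansion:
  assumes "\<And>z. norm z \<le> 1 \<Longrightarrow> lag_poly q \<beta> z \<noteq> 0"
  obtains c :: "nat \<Rightarrow> complex" where "summable (\<lambda>k. norm (c k))"
    and "\<And>z. norm z < 1 \<Longrightarrow> (\<lambda>k. c k * z ^ k) sums (lag_poly p \<alpha> z / lag_poly q \<beta> z)"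
proof -
  define U where "U = {z. lag_poly q \<beta> z \<noteq> 0}"
  have "open U"
  proof -
    have "continuous_on UNIV (lag_poly q \<beta>)"
      by (intro holomorphic_on_imp_continuous_on holomorphic_intros)
    then have "open (lag_poly q \<beta> -` (- {0}))"
      by (intro open_vimage) auto
    then show ?thesis by (simp add: U_def vimage_def)
  qed
  moreover have "cball 0 1 \<subseteq> U"
    using assms by (auto simp: U_def)
  ultimately obtain e where e: "e > 0" "{y. infdist y (cball 0 1) \<le> e} \<subseteq> U"
    using compact_in_open_separated[of "cball (0::complex) 1" U]
    by (metis compact_cball cball_eq_empty not_one_less_zero)
  define f where "f = (\<lambda>z. lag_poly p \<alpha> z / lag_poly q \<beta> z)"
  define c where "c = (\<lambda>k. (deriv ^^ k) f 0 / fact k)"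
  have ball: "ball 0 (1 + e) \<subseteq> U"
  proof
    fix z :: complex assume z: "z \<in> ball 0 (1 + e)"
    show "z \<in> U"
    proof (cases "norm z \<le> 1")
      case True
      then show ?thesis using assms by (simp add: U_def)
    next
      case False
      \<comment> \<open>Outside the closed disc \<open>sgn z\<close> is the radial projection of
        \<open>z\<close> onto it, at distance \<open>norm z - 1 < e\<close>.\<close>
      have "infdist z (cball 0 1) \<le> dist z (sgn z)"
        by (rule infdist_le) (simp add: norm_sgn)
      also have "z - sgn z = (1 - inverse (norm z)) *\<^sub>R z"
        by (simp add: sgn_div_norm algebra_simps)
      then have "dist z (sgn z) = \<bar>1 - inverse (norm z)\<bar> * norm z"
        unfolding dist_norm by (simp only: norm_scaleR)
      also have "\<dots> = norm z - 1"
        using False by (subst abs_of_nonneg) (auto simp: divide_simps algebra_simps)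
      finally show ?thesis using z e(2) by auto
    qed
  qed
  then have hol: "f holomorphic_on ball 0 (1 + e)"
    unfolding f_def by (intro holomorphic_intros) (auto simp: U_def)
  have sums: "(\<lambda>k. c k * z ^ k) sums f z" if "norm z < 1 + e" for z
    using holomorphic_power_series[OF hol, of z] that by (simp add: c_def)
  show ?thesis
  proof
    \<comment> \<open>Any radius strictly between 1 and \<open>1 + e\<close> would serve as the
      comparison point.\<close>
    have "summable (\<lambda>k. c k * of_real (1 + e / 2) ^ k)"
      using sums[of "of_real (1 + e / 2)"] e(1) by (simp add: sums_iff del: of_real_add)
    then show "summable (\<lambda>k. norm (c k))"
      using powser_insidea[of c "of_real (1 + e / 2)" 1] e(1) by (simp del: of_real_add)
    show "(\<lambda>k. c k * z ^ k) sums (lag_poly p \<alpha> z / lag_poly q \<beta> z)" if "norm z < 1" for z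
      using sums[of z] that e(1) by (simp add: f_def)
  qed
qed

lemma (in fiegarch) summable_lam_square:
  assumes "d < 1 / 2"
  shows "summable (\<lambda>k. (lam k)\<^sup>2)"
proof -
  obtain c :: "nat \<Rightarrow> complex" where c: "summable (\<lambda>k. norm (c k))"
    and c_sums: "\<And>z. norm z < 1 \<Longrightarrow> (\<lambda>k. c k * z ^ k) sums (lag_poly p \<alpha> z / lag_poly q \<beta> z)"
    using lag_poly_ratio_expansion[OF \<beta>_nonzero] by blast
  have near: "\<forall>\<^sub>F z in nhds (0::complex). norm z < 1"
    using eventually_nhds_in_open[of "ball (0::complex) 1" 0] by simp
  \<comment> \<open>The binomial series of exponent \<open>- d\<close> at \<open>- z\<close>; the
    signs disappear on squaring.\<close>
  define b where "b = (\<lambda>k. (- d gchoose k) * (- 1) ^ k)"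
  have b_sums: "(\<lambda>k. of_real (b k) * z ^ k) sums (1 - z) powr (- of_real d)" if "norm z < 1" for z :: complex
  proof -
    have "of_real (b k) * z ^ k = (of_real (- d) gchoose k) * (- z) ^ k" for k
      by (simp add: b_def power_minus[of z] gbinomial_prod_rev mult.assoc)
    then show ?thesis
      using gen_binomial_complex[of "- z" "of_real (- d)"] that by simp
  qed
  have "(\<lambda>z. lag_poly p \<alpha> z / lag_poly q \<beta> z) has_fps_expansion Abs_fps c"
    using near by (intro has_fps_expansionI) (auto elim!: eventually_mono dest: c_sums)
  moreover have "(\<lambda>z. (1 - z) powr (- of_real d)) has_fps_expansion Abs_fps (\<lambda>k. complex_of_real (b k))"
    using near by (intro has_fps_expansionI) (auto elim!: eventually_mono dest: b_sums)
  ultimately have "(\<lambda>z. lag_poly p \<alpha> z / lag_poly q \<beta> z * (1 - z) powr (- of_real d))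
      has_fps_expansion Abs_fps c * Abs_fps (\<lambda>k. of_real (b k))"
    by (rule has_fps_expansion_mult)
  moreover have "(\<lambda>z. lag_poly p \<alpha> z / lag_poly q \<beta> z * (1 - z) powr (- of_real d))
      has_fps_expansion Abs_fps (\<lambda>k. of_real (lam k))"
    using near by (intro has_fps_expansionI) (auto elim!: eventually_mono dest: lam_expansion)
  ultimately have eq: "Abs_fps (\<lambda>k. of_real (lam k)) = Abs_fps c * Abs_fps (\<lambda>k. complex_of_real (b k))"
    by (rule fps_expansion_unique_complex[rotated])
  \<comment> \<open>The \<open>c i\<close> come from complex analysis and are not known to be real.
    Since \<open>lam\<close> and \<open>b\<close> are real, taking real parts of the convolution
    identity suffices.\<close>
  have "lam k = (\<Sum>i\<le>k. Re (c i) * b (k - i))" for k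
  proof -
    have "complex_of_real (lam k) = (\<Sum>i\<le>k. c i * of_real (b (k - i)))"
      using arg_cong[OF eq, of "\<lambda>F. fps_nth F k"] by (simp add: fps_mult_nth atLeast0AtMost)
    from arg_cong[OF this, of Re] show ?thesis by simp
  qed
  moreover have "summable (\<lambda>k. \<bar>Re (c k)\<bar>)"
    using c by (rule summable_comparison_test'[where N = 0]) (simp add: abs_Re_le_cmod)
  moreover have "summable (\<lambda>k. (b k)\<^sup>2)"
    using summable_square_gbinomial[OF assms]
    by (simp add: b_def power_mult_distrib flip: power_mult)
  ultimately show ?thesis
    using summable_square_convolution[of "\<lambda>i. Re (c i)" b] by presburger
qed

section \<open>Almost sure convergence of independent series\<close>

context prob_space
begin

text \<open>Applied both to the tails of a series and to the innovations read backwards from a time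
  t. Injectivity makes the singleton blocks \<open>{f j}\<close> disjoint.\<close>

lemma indep_vars_inj_reindex:
  assumes "indep_vars (\<lambda>_. N) X I" and f: "inj_on f J" "f ` J \<subseteq> I"
  shows "indep_vars (\<lambda>_. N) (\<lambda>j. X (f j)) J"
proof -
  have "indep_vars (\<lambda>j. PiM {f j} (\<lambda>_. N)) (\<lambda>j x. restrict (\<lambda>i. X i x) {f j}) J"
    using f by (intro indep_vars_restrict[OF assms(1)])
      (auto simp: disjoint_family_on_def inj_on_def)
  then have "indep_vars (\<lambda>_. N) (\<lambda>j x. (restrict (\<lambda>i. X i x) {f j}) (f j)) J"
    by (rule indep_vars_compose2[where Y = "\<lambda>j y. y (f j)"]) simp
  then show ?thesis by simp
qed

section \<open>Orthogonality of past and future, and Kolmogorov's maximal inequality\<close>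

context
  fixes X :: "nat \<Rightarrow> 'a \<Rightarrow> real"
  assumes indep: "indep_vars (\<lambda>_. borel) X UNIV"
    and square_integrable: "\<And>i. integrable M (\<lambda>x. (X i x)\<^sup>2)"
    and centered: "\<And>i. expectation (X i) = 0"
begin

lemma indep_borel_measurable: "X i \<in> borel_measurable M"
  using indep by (auto simp: indep_vars_def)

lemma indep_integrable: "integrable M (X i)"
  using indep_borel_measurable square_integrable by (rule square_integrable_imp_integrable)

text \<open>The martingale difference property without conditional expectations: a function of the
  first k coordinates is independent of the centred later block. Independence also makes the product
  of the two integrable factors integrable.\<close>

lemma past_future_orthogonal:
  assumes F: "F \<in> borel_measurable (PiM {..<k} (\<lambda>_. borel))"
    and int: "integrable M (\<lambda>x. F (restrict (\<lambda>i. X i x) {..<k}))"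
  shows "integrable M (\<lambda>x. F (restrict (\<lambda>i. X i x) {..<k}) * (\<Sum>i=k..<n. X i x))"
    and "expectation (\<lambda>x. F (restrict (\<lambda>i. X i x) {..<k}) * (\<Sum>i=k..<n. X i x)) = 0"
proof -
  have "indep_var (PiM {..<k} (\<lambda>_. borel)) (\<lambda>x. restrict (\<lambda>i. X i x) {..<k})
      (PiM {k..<n} (\<lambda>_. borel)) (\<lambda>x. restrict (\<lambda>i. X i x) {k..<n})"
    by (rule indep_var_restrict[OF indep]) auto
  then have "indep_var borel (F \<circ> (\<lambda>x. restrict (\<lambda>i. X i x) {..<k}))
      borel ((\<lambda>f. \<Sum>i=k..<n. f i) \<circ> (\<lambda>x. restrict (\<lambda>i. X i x) {k..<n}))"
    by (rule indep_var_compose[OF _ F]) simp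
  then have ind: "indep_var borel (\<lambda>x. F (restrict (\<lambda>i. X i x) {..<k})) borel (\<lambda>x. \<Sum>i=k..<n. X i x)"
    by (simp add: comp_def)
  have int2: "integrable M (\<lambda>x. \<Sum>i=k..<n. X i x)"
    by (intro Bochner_Integration.integrable_sum indep_integrable)
  show "integrable M (\<lambda>x. F (restrict (\<lambda>i. X i x) {..<k}) * (\<Sum>i=k..<n. X i x))"
    by (rule indep_var_integrable[OF ind int int2])
  have "expectation (\<lambda>x. \<Sum>i=k..<n. X i x) = 0"
    using indep_integrable by (simp add: centered)
  then show "expectation (\<lambda>x. F (restrict (\<lambda>i. X i x) {..<k}) * (\<Sum>i=k..<n. X i x)) = 0"
    using indep_var_lebesgue_integral[OF ind int int2] by simp
qed

lemma partial_sum_square: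
  shows "integrable M (\<lambda>x. (\<Sum>i<n. X i x)\<^sup>2)"
    and "expectation (\<lambda>x. (\<Sum>i<n. X i x)\<^sup>2) = (\<Sum>i<n. expectation (\<lambda>x. (X i x)\<^sup>2))"
proof (induction n)
  case (Suc n)
  have int: "integrable M (\<lambda>x. \<Sum>i<n. restrict (\<lambda>i. X i x) {..<n} i)"
    using indep_integrable by (intro Bochner_Integration.integrable_sum) auto
  have meas: "(\<lambda>f. \<Sum>i<n. f i) \<in> borel_measurable (PiM {..<n} (\<lambda>_. borel :: real measure))"
    by (intro borel_measurable_sum measurable_component_singleton) auto
  \<comment> \<open>With \<open>Suc n\<close> as upper end the future block
    \<open>{n..<Suc n}\<close> is the single term \<open>X n\<close>.\<close>
  note orth = past_future_orthogonal[OF meas int, of "Suc n", simplified]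
  have eq: "(\<Sum>i<Suc n. X i x)\<^sup>2 = (\<Sum>i<n. X i x)\<^sup>2 + (2 * ((\<Sum>i<n. X i x) * X n x) + (X n x)\<^sup>2)" for x
    by (simp add: power2_eq_square algebra_simps)
  { case 1
    show ?case
      unfolding eq by (intro Bochner_Integration.integrable_add Suc.IH square_integrable
          integrable_mult_right orth) }
  { case 2
    show ?case
      unfolding eq using Suc.IH orth square_integrable
      by (subst Bochner_Integration.integral_add | simp)+ }
qed simp_all

text \<open>Split the event by the first index k at which a partial sum reaches \<epsilon>. The part
  \<open>A k\<close> and the sum \<open>S k\<close> depend on the past of k only, hence are
  orthogonal to the remaining increment, so the second moment of \<open>S n\<close> on
  \<open>A k\<close> is at least that of \<open>S k\<close>.\<close>

lemma kolmogorov_maximal_inequality: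
  assumes "\<epsilon> > 0"
  shows "prob {x \<in> space M. \<exists>k\<le>n. \<epsilon> \<le> \<bar>\<Sum>i<k. X i x\<bar>} * \<epsilon>\<^sup>2 \<le> (\<Sum>i<n. expectation (\<lambda>x. (X i x)\<^sup>2))"
proof -
  note [measurable] = indep_borel_measurable
  define S where "S k x = (\<Sum>i<k. X i x)" for k x
  \<comment> \<open>Formulated for coordinate sequences instead of sample points, so that first
    passage at k is visibly a function of the coordinates below k.\<close>
  define first where "first k f \<longleftrightarrow> \<epsilon> \<le> \<bar>\<Sum>i<k. f i\<bar> \<and> (\<forall>j\<in>{..<k}. \<bar>\<Sum>i<j. f i\<bar> < \<epsilon>)"
    for k and f :: "nat \<Rightarrow> real"
  define A where "A k = {x \<in> space M. first k (\<lambda>i. X i x)}" for k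
  have S_measurable [measurable]: "S k \<in> borel_measurable M" for k
    unfolding S_def by measurable
  have A_sets [measurable]: "A k \<in> sets M" for k
    unfolding A_def first_def by measurable
  have int_n: "integrable M (\<lambda>x. (S n x)\<^sup>2)"
    unfolding S_def by (rule partial_sum_square)
  have key: "prob (A k) * \<epsilon>\<^sup>2 \<le> expectation (\<lambda>x. indicator (A k) x * (S n x)\<^sup>2)" if "k \<le> n" for k
  proof -
    define F where "F f = (if first k f then \<Sum>i<k. f i else 0)" for f
    have F_eq: "F (restrict (\<lambda>i. X i x) {..<k}) = indicator (A k) x * S k x" if "x \<in> space M" for x
    proof -
      have "first k (restrict (\<lambda>i. X i x) {..<k}) = first k (\<lambda>i. X i x)"
        by (simp add: first_def cong: conj_cong)
      then show ?thesis
        using that by (simp add: F_def A_def S_def indicator_def)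
    qed
    have sum_meas: "(\<lambda>f. \<Sum>i<j. f i) \<in> borel_measurable (PiM {..<k} (\<lambda>_. borel :: real measure))" if "j \<le> k" for j
      using that by (intro borel_measurable_sum measurable_component_singleton) auto
    have [measurable]: "F \<in> borel_measurable (PiM {..<k} (\<lambda>_. borel))"
      unfolding F_def first_def using sum_meas
      by (intro measurable_If pred_intros_logic pred_intros_finite) auto
    have sq_k: "integrable M (\<lambda>x. (S k x)\<^sup>2)"
      unfolding S_def by (rule partial_sum_square)
    then have "integrable M (S k)"
      by (rule square_integrable_imp_integrable[rotated]) simp
    then have int_k: "integrable M (\<lambda>x. indicator (A k) x * S k x)"
      using integrable_mult_indicator[OF A_sets, of "S k"] by simp
    then have int_F: "integrable M (\<lambda>x. F (restrict (\<lambda>i. X i x) {..<k}))"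
      by (simp add: F_eq cong: Bochner_Integration.integrable_cong)
    define R where "R x = (\<Sum>i=k..<n. X i x)" for x
    have "integrable M (\<lambda>x. indicator (A k) x * S k x * R x)"
      using past_future_orthogonal(1)[OF _ int_F, of n] unfolding R_def
      by (simp add: F_eq cong: Bochner_Integration.integrable_cong del: restrict_apply)
    moreover have "expectation (\<lambda>x. indicator (A k) x * S k x * R x) = 0"
      using past_future_orthogonal(2)[OF _ int_F, of n] unfolding R_def
      by (simp add: F_eq cong: Bochner_Integration.integral_cong del: restrict_apply)
    moreover have int_eps: "integrable M (\<lambda>x. indicator (A k) x * \<epsilon>\<^sup>2)"
      by (intro integrable_mult_left integrable_real_indicator) (auto simp: emeasure_eq_measure)
    \<comment> \<open>The cross term has expectation 0; adding it prepares the pointwise comparison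
      with the square of \<open>S k + R\<close>, from which only the square of \<open>R\<close> is
      dropped.\<close>
    ultimately have "prob (A k) * \<epsilon>\<^sup>2 = expectation (\<lambda>x. indicator (A k) x * \<epsilon>\<^sup>2 + 2 * (indicator (A k) x * S k x * R x))"
      by (subst Bochner_Integration.integral_add) simp_all
    also have "\<dots> \<le> expectation (\<lambda>x. indicator (A k) x * (S n x)\<^sup>2)"
    proof (rule integral_mono)
      show "integrable M (\<lambda>x. indicator (A k) x * (S n x)\<^sup>2)"
        using integrable_mult_indicator[OF A_sets int_n] by simp
      show "integrable M (\<lambda>x. indicator (A k) x * \<epsilon>\<^sup>2 + 2 * (indicator (A k) x * S k x * R x))"
        using int_eps \<open>integrable M (\<lambda>x. indicator (A k) x * S k x * R x)\<close> by simp
      fix x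
      have "S n x = S k x + R x"
        using that by (simp add: S_def R_def lessThan_atLeast0 sum.atLeastLessThan_concat)
      then have "(S n x)\<^sup>2 \<ge> (S k x)\<^sup>2 + 2 * (S k x * R x)"
        by (simp add: power2_sum)
      moreover have "(S k x)\<^sup>2 \<ge> \<epsilon>\<^sup>2" if "x \<in> A k"
        using that assms by (intro abs_le_square_iff[THEN iffD1]) (simp add: A_def first_def S_def)
      ultimately show "indicator (A k) x * \<epsilon>\<^sup>2 + 2 * (indicator (A k) x * S k x * R x) \<le> indicator (A k) x * (S n x)\<^sup>2"
        by (auto simp: indicator_def)
    qed
    finally show ?thesis .
  qed
  have disj: "disjoint_family_on A {..n}"
  proof -
    have "x \<notin> A k" if "x \<in> A j" "j < k" for x j k
    proof
      assume "x \<in> A k"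
      with \<open>j < k\<close> have "\<bar>\<Sum>i<j. X i x\<bar> < \<epsilon>" by (simp add: A_def first_def)
      with \<open>x \<in> A j\<close> show False by (simp add: A_def first_def)
    qed
    then show ?thesis
      unfolding disjoint_family_on_def by (metis disjoint_iff linorder_neqE_nat)
  qed
  have union: "{x \<in> space M. \<exists>k\<le>n. \<epsilon> \<le> \<bar>\<Sum>i<k. X i x\<bar>} = (\<Union>k\<le>n. A k)"
  proof (intro equalityI subsetI)
    fix x assume "x \<in> {x \<in> space M. \<exists>k\<le>n. \<epsilon> \<le> \<bar>\<Sum>i<k. X i x\<bar>}"
    then obtain k where x: "x \<in> space M" and k: "k \<le> n" "\<epsilon> \<le> \<bar>\<Sum>i<k. X i x\<bar>" by auto
    define j where "j = (LEAST j. \<epsilon> \<le> \<bar>\<Sum>i<j. X i x\<bar>)"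
    have "\<epsilon> \<le> \<bar>\<Sum>i<j. X i x\<bar>" unfolding j_def using k(2) by (rule LeastI)
    moreover have "j \<le> k" unfolding j_def using k(2) by (rule Least_le)
    moreover have "\<bar>\<Sum>i<l. X i x\<bar> < \<epsilon>" if "l < j" for l
      using not_less_Least[of l "\<lambda>j. \<epsilon> \<le> \<bar>\<Sum>i<j. X i x\<bar>"] that by (simp add: j_def)
    ultimately show "x \<in> (\<Union>k\<le>n. A k)"
      using x k(1) by (auto simp: A_def first_def intro!: bexI[of _ j])
  qed (auto simp: A_def first_def)
  have "prob (\<Union>k\<le>n. A k) * \<epsilon>\<^sup>2 = (\<Sum>k\<le>n. prob (A k) * \<epsilon>\<^sup>2)"
    using disj by (subst finite_measure_finite_Union) (auto simp: sum_distrib_right)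
  also have "\<dots> \<le> (\<Sum>k\<le>n. expectation (\<lambda>x. indicator (A k) x * (S n x)\<^sup>2))"
    by (intro sum_mono key) simp
  also have "\<dots> = expectation (\<lambda>x. \<Sum>k\<le>n. indicator (A k) x * (S n x)\<^sup>2)"
    using integrable_mult_indicator[OF A_sets int_n]
    by (subst Bochner_Integration.integral_sum) simp_all
  also have "\<dots> \<le> expectation (\<lambda>x. (S n x)\<^sup>2)"
  proof (rule integral_mono[OF _ int_n])
    show "integrable M (\<lambda>x. \<Sum>k\<le>n. indicator (A k) x * (S n x)\<^sup>2)"
      using integrable_mult_indicator[OF A_sets int_n]
      by (intro Bochner_Integration.integrable_sum) simp
    fix x
    have "(\<Sum>k\<le>n. indicator (A k) x) = (indicator (\<Union>k\<le>n. A k) x :: real)"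
      using disj by (simp add: indicator_UN_disjoint)
    then have "(\<Sum>k\<le>n. indicator (A k) x) \<le> (1::real)" by (simp add: indicator_def)
    then show "(\<Sum>k\<le>n. indicator (A k) x * (S n x)\<^sup>2) \<le> (S n x)\<^sup>2"
      by (simp add: mult_left_le_one_le sum_nonneg flip: sum_distrib_right)
  qed
  also have "\<dots> = (\<Sum>i<n. expectation (\<lambda>x. (X i x)\<^sup>2))"
    unfolding S_def by (rule partial_sum_square)
  finally show ?thesis by (simp only: union)
qed

end

text \<open>Khinchin and Kolmogorov: the maximal inequality applied to the tails of the series makes its
  partial sums almost surely Cauchy.\<close>

lemma AE_summable_indep:
  fixes X :: "nat \<Rightarrow> 'a \<Rightarrow> real"
  assumes indep: "indep_vars (\<lambda>_. borel) X UNIV"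
    and sq: "\<And>i. integrable M (\<lambda>x. (X i x)\<^sup>2)"
    and centered: "\<And>i. expectation (X i) = 0"
    and variances: "summable (\<lambda>i. expectation (\<lambda>x. (X i x)\<^sup>2))"
  shows "AE x in M. summable (\<lambda>i. X i x)"
proof -
  define v where "v i = expectation (\<lambda>x. (X i x)\<^sup>2)" for i
  have v: "summable v"
    unfolding v_def[abs_def] by (fact variances)
  have v_nonneg: "v i \<ge> 0" for i
    by (simp add: v_def)
  have [measurable]: "X i \<in> borel_measurable M" for i
    using indep by (auto simp: indep_vars_def)
  have small_tails: "AE x in M. \<exists>m. \<forall>k. \<bar>\<Sum>i<k. X (i + m) x\<bar> < \<epsilon>" if "\<epsilon> > 0" for \<epsilon>
  proof -
    \<comment> \<open>The maximal inequality handles finitely many partial sums; continuity from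
      below in n then controls all of them at once.\<close>
    define E where "E m n = {x \<in> space M. \<exists>k\<le>n. \<epsilon> \<le> \<bar>\<Sum>i<k. X (i + m) x\<bar>}" for m n :: nat
    define D where "D m = (\<Union>n. E m n)" for m
    have [measurable]: "E m n \<in> sets M" for m n
      unfolding E_def by measurable
    then have D_sets [measurable]: "D m \<in> sets M" for m
      unfolding D_def by auto
    have D_le: "prob (D m) \<le> (\<Sum>i. v (i + m)) / \<epsilon>\<^sup>2" for m
    proof (rule LIMSEQ_le_const2)
      show "(\<lambda>n. prob (E m n)) \<longlonglongrightarrow> prob (D m)"
        unfolding D_def by (rule finite_Lim_measure_incseq)
          (auto simp: incseq_def E_def intro: order_trans)
      have "prob (E m n) \<le> (\<Sum>i. v (i + m)) / \<epsilon>\<^sup>2" for n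
      proof -
        have "indep_vars (\<lambda>_. borel) (\<lambda>i. X (i + m)) UNIV"
          by (rule indep_vars_inj_reindex[OF indep]) auto
        then have "prob (E m n) * \<epsilon>\<^sup>2 \<le> (\<Sum>i<n. v (i + m))"
          unfolding E_def v_def using sq centered that by (rule kolmogorov_maximal_inequality)
        also have "\<dots> \<le> (\<Sum>i. v (i + m))"
          using v v_nonneg by (intro sum_le_suminf) auto
        finally show ?thesis using that by (simp add: field_simps)
      qed
      then show "\<exists>N. \<forall>n\<ge>N. prob (E m n) \<le> (\<Sum>i. v (i + m)) / \<epsilon>\<^sup>2" by blast
    qed
    have "prob (\<Inter>m. D m) \<le> 0"
    proof (rule LIMSEQ_le_const)
      have "(\<lambda>m. \<Sum>i. v (i + m)) \<longlonglongrightarrow> 0"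
        using v by (rule suminf_exist_split2)
      from tendsto_divide[OF this tendsto_const, of "\<epsilon>\<^sup>2"]
      show "(\<lambda>m. (\<Sum>i. v (i + m)) / \<epsilon>\<^sup>2) \<longlonglongrightarrow> 0" using that by simp
      have "prob (\<Inter>m. D m) \<le> (\<Sum>i. v (i + m)) / \<epsilon>\<^sup>2" for m
        by (rule order_trans[OF finite_measure_mono D_le]) auto
      then show "\<exists>N. \<forall>m\<ge>N. prob (\<Inter>m. D m) \<le> (\<Sum>i. v (i + m)) / \<epsilon>\<^sup>2" by blast
    qed
    then have "prob (\<Inter>m. D m) = 0"
      by (intro antisym measure_nonneg)
    then have "(\<Inter>m. D m) \<in> null_sets M"
      by (intro null_setsI) (auto simp: emeasure_eq_measure)
    then have "AE x in M. x \<notin> (\<Inter>m. D m)"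
      by (rule AE_not_in)
    then show ?thesis
      using AE_space
    proof eventually_elim
      case (elim x)
      then obtain m where "x \<notin> E m k" for k
        by (auto simp: D_def)
      then have "\<not> \<epsilon> \<le> \<bar>\<Sum>i<k. X (i + m) x\<bar>" for k
        using elim(2) by (auto simp: E_def)
      then show ?case by (auto simp: not_le)
    qed
  qed
  \<comment> \<open>Thresholds are restricted to a countable sequence so that the exceptional null
    sets can be united.\<close>
  have "AE x in M. \<forall>N. \<exists>m. \<forall>k. \<bar>\<Sum>i<k. X (i + m) x\<bar> < inverse (real (Suc N))"
    unfolding AE_all_countable by (intro allI small_tails) simp
  then show ?thesis
  proof eventually_elim
    case (elim x)
    show ?case
      unfolding summable_Cauchy
    proof (intro allI impI)
      fix e :: real assume "e > 0"
      then obtain N where N: "inverse (real (Suc N)) < e / 2"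
        using reals_Archimedean[of "e / 2"] by auto
      from elim obtain m where m: "\<And>k. \<bar>\<Sum>i<k. X (i + m) x\<bar> < inverse (real (Suc N))" by blast
      have tail: "\<bar>\<Sum>i=m..<k. X i x\<bar> < e / 2" if "m \<le> k" for k
        using m[of "k - m"] N that sum.shift_bounds_nat_ivl[of "\<lambda>i. X i x" 0 m "k - m"]
        by (simp add: lessThan_atLeast0)
      have "norm (\<Sum>i=a..<b. X i x) < e" if "m \<le> a" for a b
      proof (cases "a \<le> b")
        case True
        then have "(\<Sum>i=a..<b. X i x) = (\<Sum>i=m..<b. X i x) - (\<Sum>i=m..<a. X i x)"
          using sum.atLeastLessThan_concat[OF that True, of "\<lambda>i. X i x"] by simp
        then show ?thesis
          using tail[of a] tail[of b] that True by auto
      qed (use \<open>e > 0\<close> in simp)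
      then show "\<exists>N. \<forall>a\<ge>N. \<forall>b. norm (\<Sum>i=a..<b. X i x) < e" by blast
    qed
  qed
qed

text \<open>Fatou's lemma along the partial sums: almost sure convergence identifies the limit, and
  orthogonality bounds every second moment by the total variance.\<close>

lemma integrable_square_suminf_indep:
  fixes X :: "nat \<Rightarrow> 'a \<Rightarrow> real"
  assumes indep: "indep_vars (\<lambda>_. borel) X UNIV"
    and sq: "\<And>i. integrable M (\<lambda>x. (X i x)\<^sup>2)"
    and centered: "\<And>i. expectation (X i) = 0"
    and variances: "summable (\<lambda>i. expectation (\<lambda>x. (X i x)\<^sup>2))"
  shows "integrable M (\<lambda>x. (\<Sum>i. X i x)\<^sup>2)"
proof (rule integrableI_nonneg)
  have [measurable]: "X i \<in> borel_measurable M" for i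
    using indep by (auto simp: indep_vars_def)
  show "(\<lambda>x. (\<Sum>i. X i x)\<^sup>2) \<in> borel_measurable M" by measurable
  have "(\<integral>\<^sup>+x. ennreal ((\<Sum>i. X i x)\<^sup>2) \<partial>M) = (\<integral>\<^sup>+x. liminf (\<lambda>n. ennreal ((\<Sum>i<n. X i x)\<^sup>2)) \<partial>M)"
  proof (rule nn_integral_cong_AE)
    show "AE x in M. ennreal ((\<Sum>i. X i x)\<^sup>2) = liminf (\<lambda>n. ennreal ((\<Sum>i<n. X i x)\<^sup>2))"
      using AE_summable_indep[OF assms]
    proof eventually_elim
      case (elim x)
      then have "(\<lambda>n. ennreal ((\<Sum>i<n. X i x)\<^sup>2)) \<longlonglongrightarrow> ennreal ((\<Sum>i. X i x)\<^sup>2)"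
        by (intro tendsto_intros summable_LIMSEQ)
      then show ?case
        by (intro lim_imp_Liminf[symmetric]) simp
    qed
  qed
  also have "\<dots> \<le> liminf (\<lambda>n. \<integral>\<^sup>+x. ennreal ((\<Sum>i<n. X i x)\<^sup>2) \<partial>M)"
    by (rule nn_integral_liminf) measurable
  also have "\<dots> = liminf (\<lambda>n. ennreal (\<Sum>i<n. expectation (\<lambda>x. (X i x)\<^sup>2)))"
    using partial_sum_square[OF indep sq centered] by (simp add: nn_integral_eq_integral)
  also have "\<dots> \<le> ennreal (\<Sum>i. expectation (\<lambda>x. (X i x)\<^sup>2))"
    by (rule Liminf_le) (auto intro!: always_eventually ennreal_leI sum_le_suminf variances)
  also have "\<dots> < \<infinity>" by simp
  finally show "(\<integral>\<^sup>+x. ennreal ((\<Sum>i. X i x)\<^sup>2) \<partial>M) < \<infinity>" .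
qed simp

end

section \<open>Codings of i.i.d. sequences\<close>

definition path_shift :: "int \<Rightarrow> (int \<Rightarrow> 'b) \<Rightarrow> int \<Rightarrow> 'b" where
  "path_shift h y = (\<lambda>t. y (t + h))"

lemma path_shift_apply: "path_shift h y t = y (t + h)"
  by (simp add: path_shift_def)

lemma path_shift_add: "path_shift g (path_shift h y) = path_shift (g + h) y"
  by (simp add: path_shift_def fun_eq_iff ac_simps)

lemma measurable_path_shift [measurable]:
  "path_shift h \<in> measurable (PiM UNIV (\<lambda>_. N)) (PiM UNIV (\<lambda>_. N))"
  by (rule measurable_PiM_single') (auto simp: space_PiM path_shift_apply)

section \<open>Mixing of the Bernoulli shift\<close>

context prob_space
begin

text \<open>Here \<open>M\<close> plays the role of the law of one coordinate. It is instantiated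
  later by the distribution of a single innovation, not by the space on which the process
  lives.\<close>

abbreviation path_space :: "(int \<Rightarrow> 'a) measure" where
  "path_space \<equiv> PiM UNIV (\<lambda>_. M)"

lemma prob_space_path_space: "prob_space path_space"
  by (rule prob_space_PiM) (rule prob_space_axioms)

lemma distr_path_shift: "distr path_space path_space (path_shift h) = path_space"
  using distr_PiM_reindex[of UNIV "\<lambda>_. M" "\<lambda>t. t + h" UNIV] prob_space_axioms
  by (simp add: inj_on_def path_shift_def[abs_def] restrict_UNIV)

lemma measure_path_shift:
  assumes "B \<in> sets path_space"
  shows "measure path_space (path_shift h -` B \<inter> space path_space) = measure path_space B"
  using measure_distr[OF measurable_path_shift assms, of h] by (simp add: distr_path_shift)

text \<open>Once n exceeds all differences j - k, the coordinate sets J and K + n are disjoint. The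
  intersection is then one cylinder whose product measure factors exactly, not merely in the
  limit.\<close>

lemma path_shift_mixing_cylinder:
  assumes J: "finite J" "\<And>j. j \<in> J \<Longrightarrow> E j \<in> events" and K: "finite K" "\<And>k. k \<in> K \<Longrightarrow> F k \<in> events"
  defines "C \<equiv> {y \<in> space path_space. \<forall>j\<in>J. y j \<in> E j}"
    and "D \<equiv> {y \<in> space path_space. \<forall>k\<in>K. y k \<in> F k}"
  shows "\<forall>\<^sub>F n in sequentially. measure path_space (C \<inter> path_shift (int n) -` D)
    = measure path_space C * measure path_space D"
proof -
  interpret P: product_prob_space "\<lambda>_. M" "UNIV :: int set" by unfold_locales
  have cyl: "measure path_space {y \<in> space path_space. \<forall>j\<in>J. y j \<in> E j} = (\<Prod>j\<in>J. prob (E j))"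
    if "finite J" "\<And>j. j \<in> J \<Longrightarrow> E j \<in> events" for J and E :: "int \<Rightarrow> 'a set"
  proof -
    have "ennreal (measure path_space {y \<in> space path_space. \<forall>j\<in>J. y j \<in> E j}) = ennreal (\<Prod>j\<in>J. prob (E j))"
      using P.emeasure_PiM_Collect[of J E] that
      by (simp add: P.P.emeasure_eq_measure emeasure_eq_measure prod_ennreal)
    then show ?thesis by (simp add: prod_nonneg)
  qed
  have "\<forall>\<^sub>F n in sequentially. \<forall>j\<in>J. \<forall>k\<in>K. j \<noteq> k + int n"
  proof (intro eventually_ball_finite ballI J(1) K(1))
    fix j k
    show "\<forall>\<^sub>F n in sequentially. j \<noteq> k + int n"
      using eventually_gt_at_top[of "nat (j - k)"] by eventually_elim linarith
  qed
  then show ?thesis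
  proof eventually_elim
    case (elim n)
    define G where "G i = (if i \<in> J then E i else F (i - int n))" for i
    have disj: "J \<inter> (\<lambda>k. k + int n) ` K = {}" using elim by auto
    have G: "G j = E j" if "j \<in> J" for j
      using that by (simp add: G_def)
    have G': "G (k + int n) = F k" if "k \<in> K" for k
      using that elim by (auto simp: G_def)
    have "path_shift (int n) y \<in> space path_space" if "y \<in> space path_space" for y
      using that by (rule measurable_space[OF measurable_path_shift])
    then have "C \<inter> path_shift (int n) -` D = {y \<in> space path_space. \<forall>i\<in>J \<union> (\<lambda>k. k + int n) ` K. y i \<in> G i}"
      by (auto simp: C_def D_def G G' ball_Un path_shift_apply)
    then have "measure path_space (C \<inter> path_shift (int n) -` D) = (\<Prod>i\<in>J \<union> (\<lambda>k. k + int n) ` K. prob (G i))"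
      using J K by (simp only:) (rule cyl, auto simp: G G')
    also have "\<dots> = (\<Prod>i\<in>J. prob (G i)) * (\<Prod>i\<in>(\<lambda>k. k + int n) ` K. prob (G i))"
      using J K disj by (intro prod.union_disjoint) auto
    also have "(\<Prod>i\<in>J. prob (G i)) = measure path_space C"
      unfolding C_def using J by (subst cyl) (auto simp: G)
    also have "(\<Prod>i\<in>(\<lambda>k. k + int n) ` K. prob (G i)) = (\<Prod>k\<in>K. prob (F k))"
      by (subst prod.reindex) (auto simp: G' inj_on_def)
    also have "\<dots> = measure path_space D"
      unfolding D_def using K by (subst cyl) auto
    finally show ?case .
  qed
qed

lemma prod_algebra_cylinder:
  assumes "A \<in> prod_algebra UNIV (\<lambda>_::int. M)"
  obtains J E where "finite J" "\<And>j. j \<in> J \<Longrightarrow> E j \<in> events"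
    "A = {y \<in> space path_space. \<forall>j\<in>J. y j \<in> E j}"
proof -
  from assms obtain J E where J: "finite J" "\<And>j. j \<in> J \<Longrightarrow> E j \<in> events"
    and A: "A = prod_emb UNIV (\<lambda>_. M) J (Pi\<^sub>E J E)"
    by (rule prod_algebraE) blast
  have "A = {y \<in> space path_space. \<forall>j\<in>J. y j \<in> E j}"
    unfolding A by (auto simp: prod_emb_def space_PiM PiE_iff)
  with J show ?thesis by (rule that)
qed

text \<open>Only \<open>D\<close> is generalized, by induction over the Dynkin system generated by
  cylinders. Keeping \<open>C\<close> a cylinder is enough, because independence from cylinders
  extends to the generated sigma-algebra later.\<close>

lemma path_shift_mixing:
  assumes C: "C \<in> prod_algebra UNIV (\<lambda>_::int. M)" and D: "D \<in> sets path_space"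
  shows "(\<lambda>n. measure path_space (C \<inter> path_shift (int n) -` D))
    \<longlonglongrightarrow> measure path_space C * measure path_space D"
proof -
  interpret P: prob_space path_space by (rule prob_space_path_space)
  have C_sets [measurable]: "C \<in> sets path_space"
    using C by (auto simp: sets_PiM)
  have C_space: "C \<subseteq> space path_space" by (rule sets.sets_into_space[OF C_sets])
  have shift_sets [measurable]: "C \<inter> path_shift h -` A \<in> sets path_space" if "A \<in> sets path_space" for A h
  proof -
    have "C \<inter> path_shift h -` A = C \<inter> (path_shift h -` A \<inter> space path_space)"
      using C_space by auto
    then show ?thesis using that by simp
  qed
  have "D \<in> sigma_sets (space path_space) (prod_algebra UNIV (\<lambda>_. M))"
    using D by (simp add: sets_PiM space_PiM)
  with Int_stable_prod_algebra prod_algebra_sets_into_space[of UNIV "\<lambda>_. M", folded space_PiM]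
  show ?thesis
  proof (induction rule: sigma_sets_induct_disjoint)
    case (basic A)
    from C obtain J E where "finite J" "\<And>j. j \<in> J \<Longrightarrow> E j \<in> events"
      "C = {y \<in> space path_space. \<forall>j\<in>J. y j \<in> E j}" by (rule prod_algebra_cylinder) blast
    moreover from basic obtain K F where "finite K" "\<And>k. k \<in> K \<Longrightarrow> F k \<in> events"
      "A = {y \<in> space path_space. \<forall>k\<in>K. y k \<in> F k}" by (rule prod_algebra_cylinder) blast
    ultimately show ?case
      by (simp only:) (intro tendsto_eventually path_shift_mixing_cylinder)
  next
    case empty
    show ?case by simp
  next
    case (compl A)
    then have A [measurable]: "A \<in> sets path_space" by (simp add: sets_PiM space_PiM)
    have "measure path_space (C \<inter> path_shift h -` (space path_space - A))
      = measure path_space C - measure path_space (C \<inter> path_shift h -` A)" for h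
    proof -
      have "C \<inter> path_shift h -` (space path_space - A) = C - (C \<inter> path_shift h -` A)"
        using C_space measurable_space[OF measurable_path_shift[of h "M"]] by blast
      then show ?thesis
        by (simp only:) (rule P.finite_measure_Diff, auto)
    qed
    moreover have "measure path_space C * measure path_space (space path_space - A)
      = measure path_space C - measure path_space C * measure path_space A"
      by (simp add: P.prob_compl algebra_simps)
    ultimately show ?case
      using tendsto_diff[OF tendsto_const compl.IH] by simp
  next
    case (union A)
    then have A [measurable]: "A i \<in> sets path_space" for i by (auto simp: sets_PiM space_PiM)
    have sums: "(\<lambda>i. measure path_space (C \<inter> path_shift h -` A i)) sums
      measure path_space (C \<inter> path_shift h -` (\<Union>i. A i))" for h
    proof -
      have "(\<lambda>i. measure path_space (C \<inter> path_shift h -` A i)) sums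
          measure path_space (\<Union>i. C \<inter> path_shift h -` A i)"
        using union(1) by (intro P.finite_measure_UNION) (auto simp: disjoint_family_on_def)
      then show ?thesis by (simp only: vimage_UN Int_UN_distrib)
    qed
    have sums_A: "(\<lambda>i. measure path_space (A i)) sums measure path_space (\<Union>i. A i)"
      using union(1) by (intro P.finite_measure_UNION) auto
    have "(\<lambda>n. \<Sum>i. measure path_space (C \<inter> path_shift (int n) -` A i))
      \<longlonglongrightarrow> (\<Sum>i. measure path_space C * measure path_space (A i))"
    \<comment> \<open>Limit and infinite sum are exchanged by dominated convergence. Shift
      invariance supplies the bound \<open>measure path_space (A i)\<close>, which is uniform in n
      and summable because the sets are disjoint.\<close>
    proof (rule tannerys_theorem[THEN conjunct2, THEN conjunct2])
      show "((\<lambda>n. measure path_space (C \<inter> path_shift (int n) -` A i))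
        \<longlongrightarrow> measure path_space C * measure path_space (A i)) sequentially" for i
        using union(3) .
      show "\<forall>\<^sub>F (k, n) in at_top \<times>\<^sub>F sequentially.
          norm (measure path_space (C \<inter> path_shift (int n) -` A k)) \<le> measure path_space (A k)"
      proof (intro always_eventually allI, clarify)
        fix k n
        have "measure path_space (C \<inter> path_shift (int n) -` A k)
          \<le> measure path_space (path_shift (int n) -` A k \<inter> space path_space)"
          using C_space by (intro P.finite_measure_mono) auto
        then show "norm (measure path_space (C \<inter> path_shift (int n) -` A k)) \<le> measure path_space (A k)"
          by (simp add: measure_path_shift)
      qed
      show "summable (\<lambda>i. measure path_space (A i))"
        using sums_A by (rule sums_summable)
    qed simp
    then show ?case
      using sums_A sums by (simp add: sums_iff suminf_mult)
  qed
qed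

text \<open>Mixing makes an invariant event independent of every cylinder, hence of itself.\<close>

lemma path_shift_invariant_prob_0_1:
  assumes B [measurable]: "B \<in> sets path_space"
    and inv: "path_shift 1 -` B \<inter> space path_space = B"
  shows "measure path_space B \<in> {0, 1}"
proof -
  interpret P: prob_space path_space by (rule prob_space_path_space)
  have inv_n: "path_shift (int n) -` B \<inter> space path_space = B" for n
  proof (induction n)
    case 0
    show ?case using sets.sets_into_space[OF B] by (auto simp: path_shift_def)
  next
    case (Suc n)
    have "path_shift (int (Suc n)) y \<in> B \<longleftrightarrow> y \<in> B" if y: "y \<in> space path_space" for y
    proof -
      have "path_shift (int n) y \<in> space path_space"
        using y by (rule measurable_space[OF measurable_path_shift])
      moreover have "path_shift (int (Suc n)) y = path_shift 1 (path_shift (int n) y)"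
        by (simp add: path_shift_add)
      ultimately have "path_shift (int (Suc n)) y \<in> B \<longleftrightarrow> path_shift (int n) y \<in> B"
        using inv by auto
      also have "\<dots> \<longleftrightarrow> y \<in> B" using Suc y by auto
      finally show ?thesis .
    qed
    then show ?case using sets.sets_into_space[OF B] by blast
  qed
  \<comment> \<open>By invariance the sequence in the mixing limit is constant, so its value must
    equal the limit.\<close>
  have indep_C: "measure path_space (C \<inter> B) = measure path_space C * measure path_space B"
    if C: "C \<in> prod_algebra UNIV (\<lambda>_::int. M)" for C
  proof (rule LIMSEQ_unique)
    have "C \<subseteq> space path_space"
      by (rule sets.sets_into_space) (use C in \<open>auto simp: sets_PiM\<close>)
    then have "C \<inter> path_shift (int n) -` B = C \<inter> B" for n
      using inv_n[of n] by auto
    then show "(\<lambda>n. measure path_space (C \<inter> path_shift (int n) -` B)) \<longlonglongrightarrow> measure path_space (C \<inter> B)"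
      by simp
    show "(\<lambda>n. measure path_space (C \<inter> path_shift (int n) -` B))
      \<longlonglongrightarrow> measure path_space C * measure path_space B"
      using C B by (rule path_shift_mixing)
  qed
  \<comment> \<open>Cylinders are closed under intersection, so independence from \<open>B\<close>
    passes to the sigma-algebra they generate, which contains \<open>B\<close>. The probability of
    \<open>B\<close> then equals its own square.\<close>
  have "P.indep_set (sigma_sets (space path_space) (prod_algebra UNIV (\<lambda>_::int. M)))
      (sigma_sets (space path_space) {B})"
  proof (rule P.indep_set_sigma_sets)
    show "P.indep_set (prod_algebra UNIV (\<lambda>_. M)) {B}"
    proof (rule P.indep_setI)
      show "prod_algebra UNIV (\<lambda>_. M) \<subseteq> P.events" by (auto simp: sets_PiM)
    qed (auto simp: indep_C)
    show "Int_stable (prod_algebra UNIV (\<lambda>_::int. M))" by (rule Int_stable_prod_algebra)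
    show "Int_stable {B}" by (simp add: Int_stable_def)
  qed
  then have "P.prob (B \<inter> B) = P.prob B * P.prob B"
    by (rule P.indep_setD) (use B in \<open>simp_all add: sets_PiM space_PiM\<close>)
  then show ?thesis by simp
qed

text \<open>The coding identity is required only almost everywhere because the model says nothing about the
  volatility where its defining series diverges.\<close>

context
  fixes Z :: "int \<Rightarrow> 'a \<Rightarrow> real" and Y :: "int \<Rightarrow> 'a \<Rightarrow> real" and f :: "(int \<Rightarrow> real) \<Rightarrow> real"
  assumes Z_indep: "indep_vars (\<lambda>_. borel) Z UNIV"
    and Z_ident: "\<And>s t. distr M borel (Z s) = distr M borel (Z t)"
    and f [measurable]: "f \<in> borel_measurable (PiM UNIV (\<lambda>_. borel))"
    and Y [measurable]: "\<And>t. Y t \<in> borel_measurable M"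
    and Y_eq: "\<And>t. AE x in M. Y t x = f (path_shift t (\<lambda>s. Z s x))"
begin

text \<open>The bridge from \<open>M\<close> to the canonical shift: the law of the entire path is a
  power of one marginal \<mu>, for which the results on \<open>path_space\<close> can be
  interpreted.\<close>

lemma coding_iid:
  obtains \<mu> :: "real measure" where "prob_space \<mu>" "sets \<mu> = sets borel"
    "distr M (PiM UNIV (\<lambda>_. borel)) (\<lambda>x s. Z s x) = PiM UNIV (\<lambda>_::int. \<mu>)"
proof
  have Z: "Z s \<in> borel_measurable M" for s
    using Z_indep by (auto simp: indep_vars_def)
  show "prob_space (distr M borel (Z 0))" by (rule prob_space_distr[OF Z])
  show "sets (distr M borel (Z 0)) = sets borel" by simp
  have "distr M (PiM UNIV (\<lambda>_. borel)) (\<lambda>x s. Z s x) = PiM UNIV (\<lambda>s. distr M borel (Z s))"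
    using indep_vars_iff_distr_eq_PiM[where I = UNIV and M' = "\<lambda>_. borel" and X = Z] Z_indep Z by (simp add: restrict_UNIV)
  also have "\<dots> = PiM UNIV (\<lambda>_::int. distr M borel (Z 0))"
    by (intro PiM_cong refl Z_ident)
  finally show "distr M (PiM UNIV (\<lambda>_. borel)) (\<lambda>x s. Z s x) = PiM UNIV (\<lambda>_::int. distr M borel (Z 0))" .
qed

lemma Z_paths_measurable: "(\<lambda>x s. Z s x) \<in> measurable M (PiM UNIV (\<lambda>_. borel))"
  using Z_indep by (intro measurable_PiM_single') (auto simp: indep_vars_def)

lemma coding_strictly_stationary: "strictly_stationary M Y"
  unfolding strictly_stationary_def
proof (intro conjI allI impI Y)
  note [measurable] = Z_paths_measurable
  fix J :: "int set" and h :: int assume J: "finite J"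
  obtain \<mu> :: "real measure" where \<mu>: "prob_space \<mu>" "sets \<mu> = sets borel"
    and distr_Z: "distr M (PiM UNIV (\<lambda>_. borel)) (\<lambda>x s. Z s x) = PiM UNIV (\<lambda>_::int. \<mu>)"
    by (rule coding_iid)
  interpret \<mu>: prob_space \<mu> by fact
  have sets_eq: "sets (PiM UNIV (\<lambda>_::int. \<mu>)) = sets (PiM UNIV (\<lambda>_. borel))"
    by (intro sets_PiM_cong refl \<mu>)
  have code [measurable]: "(\<lambda>y. \<lambda>t\<in>J. f (path_shift (t + g) y)) \<in>
      measurable (PiM UNIV (\<lambda>_. borel)) (PiM J (\<lambda>_. borel))" for g
    by measurable
  have code_\<mu>: "(\<lambda>y. \<lambda>t\<in>J. f (path_shift t y)) \<in> measurable (PiM UNIV (\<lambda>_. \<mu>)) (PiM J (\<lambda>_. borel))"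
    using code[of 0] by (simp add: measurable_cong_sets[OF sets_eq refl])
  \<comment> \<open>The right-hand side is free of \<open>g\<close>: pushing forward along
    \<open>Z\<close> turns the time shift into a path shift, which the product measure absorbs. The
    cases \<open>g = h\<close> and \<open>g = 0\<close> then give stationarity.\<close>
  have "distr M (PiM J (\<lambda>_. borel)) (\<lambda>x. \<lambda>t\<in>J. Y (t + g) x) =
      distr (PiM UNIV (\<lambda>_. \<mu>)) (PiM J (\<lambda>_. borel)) (\<lambda>y. \<lambda>t\<in>J. f (path_shift t y))" for g
  proof -
    have "AE x in M. \<forall>t\<in>J. Y (t + g) x = f (path_shift (t + g) (\<lambda>s. Z s x))"
      using J Y_eq by (intro AE_finite_allI)
    then have "distr M (PiM J (\<lambda>_. borel)) (\<lambda>x. \<lambda>t\<in>J. Y (t + g) x) =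
        distr M (PiM J (\<lambda>_. borel)) (\<lambda>x. \<lambda>t\<in>J. f (path_shift (t + g) (\<lambda>s. Z s x)))"
      by (intro distr_cong_AE refl) (auto elim!: eventually_mono)
    also have "\<dots> = distr (distr M (PiM UNIV (\<lambda>_. borel)) (\<lambda>x s. Z s x)) (PiM J (\<lambda>_. borel))
        (\<lambda>y. \<lambda>t\<in>J. f (path_shift (t + g) y))"
      by (subst distr_distr) (auto simp: comp_def)
    also have "\<dots> = distr (PiM UNIV (\<lambda>_. \<mu>)) (PiM J (\<lambda>_. borel)) (\<lambda>y. \<lambda>t\<in>J. f (path_shift t (path_shift g y)))"
      by (simp only: distr_Z path_shift_add)
    also have "\<dots> = distr (distr (PiM UNIV (\<lambda>_. \<mu>)) (PiM UNIV (\<lambda>_. \<mu>)) (path_shift g))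
        (PiM J (\<lambda>_. borel)) (\<lambda>y. \<lambda>t\<in>J. f (path_shift t y))"
      using distr_distr[OF code_\<mu> measurable_path_shift] by (simp add: comp_def)
    also have "\<dots> = distr (PiM UNIV (\<lambda>_. \<mu>)) (PiM J (\<lambda>_. borel)) (\<lambda>y. \<lambda>t\<in>J. f (path_shift t y))"
      by (simp only: \<mu>.distr_path_shift)
    finally show ?thesis .
  qed
  from this[of h] this[of 0]
  show "distr M (PiM J (\<lambda>_. borel)) (\<lambda>x. \<lambda>t\<in>J. Y (t + h) x) =
      distr M (PiM J (\<lambda>_. borel)) (\<lambda>x. \<lambda>t\<in>J. Y t x)"
    by simp
qed

lemma coding_ergodic: "ergodic_process M Y"
  unfolding ergodic_process_def
proof (intro conjI allI ballI impI Y)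
  note [measurable] = Z_paths_measurable
  fix A :: "(int \<Rightarrow> real) set"
  assume A [measurable]: "A \<in> sets (PiM UNIV (\<lambda>_. borel))" and inv: "(\<lambda>y t. y (t + 1)) -` A = A"
  obtain \<mu> :: "real measure" where \<mu>: "prob_space \<mu>" "sets \<mu> = sets borel"
    and distr_Z: "distr M (PiM UNIV (\<lambda>_. borel)) (\<lambda>x s. Z s x) = PiM UNIV (\<lambda>_::int. \<mu>)"
    by (rule coding_iid)
  interpret \<mu>: prob_space \<mu> by fact
  have sets_eq: "sets (PiM UNIV (\<lambda>_::int. \<mu>)) = sets (PiM UNIV (\<lambda>_. borel))"
    by (intro sets_PiM_cong refl \<mu>)
  have space_eq: "space (PiM UNIV (\<lambda>_::int. \<mu>)) = UNIV"
    using sets_eq_imp_space_eq[OF sets_eq] by (simp add: space_PiM)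
  define F where "F y = (\<lambda>t. f (path_shift t y))" for y
  have F [measurable]: "F \<in> measurable (PiM UNIV (\<lambda>_. borel)) (PiM UNIV (\<lambda>_. borel))"
    unfolding F_def by (rule measurable_PiM_single') auto
  \<comment> \<open>\<open>F\<close> commutes with the shift, so pulling back an invariant set of
    \<open>Y\<close> paths gives an invariant set of \<open>Z\<close> paths.\<close>
  define B where "B = F -` A"
  have B: "B \<in> sets (PiM UNIV (\<lambda>_. borel))"
    using measurable_sets[OF F A] by (simp add: B_def space_PiM)
  have "F (path_shift 1 y) = (\<lambda>t. F y (t + 1))" for y
    by (simp add: F_def path_shift_add)
  moreover have "(\<lambda>t. z (t + 1)) \<in> A \<longleftrightarrow> z \<in> A" for z
    using inv by auto
  ultimately have "path_shift 1 -` B = B"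
    by (auto simp: B_def)
  then have "measure (PiM UNIV (\<lambda>_. \<mu>)) B \<in> {0, 1}"
    using B by (intro \<mu>.path_shift_invariant_prob_0_1) (auto simp: sets_eq space_eq)
  also have "measure (PiM UNIV (\<lambda>_. \<mu>)) B = prob ((\<lambda>x s. Z s x) -` B \<inter> space M)"
    unfolding distr_Z[symmetric] using B by (rule measure_distr[rotated]) simp
  also have "\<dots> = prob {x \<in> space M. (\<lambda>t. Y t x) \<in> A}"
  proof (rule measure_eq_AE)
    \<comment> \<open>The index set is countable, so one null set serves the whole path.\<close>
    have "AE x in M. \<forall>t. Y t x = f (path_shift t (\<lambda>s. Z s x))"
      using Y_eq by (simp add: AE_all_countable)
    then show "AE x in M. x \<in> (\<lambda>x s. Z s x) -` B \<inter> space M \<longleftrightarrow> x \<in> {x \<in> space M. (\<lambda>t. Y t x) \<in> A}"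
      by (rule eventually_mono) (simp add: B_def F_def conj_commute)
    show "(\<lambda>x s. Z s x) -` B \<inter> space M \<in> events"
      using B by (intro measurable_sets[OF Z_paths_measurable])
    have "(\<lambda>x t. Y t x) \<in> measurable M (PiM UNIV (\<lambda>_. borel))"
      by (rule measurable_PiM_single') auto
    from measurable_sets[OF this A] show "{x \<in> space M. (\<lambda>t. Y t x) \<in> A} \<in> events"
      by (simp add: vimage_def Int_def conj_commute)
  qed
  finally show "prob {x \<in> space M. (\<lambda>t. Y t x) \<in> A} \<in> {0, 1}" .
qed

end

lemma strictly_stationary_imp_weakly_stationary:
  assumes "strictly_stationary M Y" and sq: "\<And>t. integrable M (\<lambda>x. (Y t x)\<^sup>2)"
  shows "weakly_stationary M Y"
proof -
  have [measurable]: "Y t \<in> borel_measurable M" for t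
    using assms(1) by (auto simp: strictly_stationary_def)
  \<comment> \<open>Means and covariances are both expectations of some G of two coordinates: a
    projection for the former, a product centred at fixed constants for the latter.\<close>
  have invariant: "expectation (\<lambda>x. G (Y (s + h) x) (Y (t + h) x)) = expectation (\<lambda>x. G (Y s x) (Y t x))"
    if G: "(\<lambda>(u, v). G u v) \<in> borel_measurable (borel \<Otimes>\<^sub>M borel)" for G :: "real \<Rightarrow> real \<Rightarrow> real" and s t h
  proof -
    have comp: "(\<lambda>y. G (y s) (y t)) \<in> borel_measurable (PiM {s, t} (\<lambda>_. borel))"
    proof -
      have "(\<lambda>y. (y s, y t)) \<in> measurable (PiM {s, t} (\<lambda>_. borel)) (borel \<Otimes>\<^sub>M borel)"
        by measurable
      from measurable_compose[OF this G] show ?thesis by simp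
    qed
    have "expectation (\<lambda>x. G (Y (s + g) x) (Y (t + g) x)) =
        (LINT y|distr M (PiM {s, t} (\<lambda>_. borel)) (\<lambda>x. \<lambda>t\<in>{s, t}. Y (t + g) x). G (y s) (y t))" for g
      by (subst integral_distr[OF _ comp]) auto
    from this[of h] this[of 0] show ?thesis
      using assms(1) by (simp add: strictly_stationary_def)
  qed
  have mean: "expectation (Y s) = expectation (Y t)" for s t
    using invariant[of "\<lambda>u v. u" t "s - t" t] by simp
  have "covariance M (Y (s + h)) (Y (t + h)) = covariance M (Y s) (Y t)" for s t h
    unfolding covariance_def
    using invariant[of "\<lambda>u v. (u - expectation (Y s)) * (v - expectation (Y t))" s h t]
      mean[of "s + h" s] mean[of "t + h" t]
    by simp
  with mean sq show ?thesis
    unfolding weakly_stationary_def by auto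
qed

end

section \<open>The log-volatility of a FIEGARCH process\<close>

context fiegarch
begin

lemma Z_measurable [measurable]: "Z t \<in> borel_measurable M"
  using Z_indep by (auto simp: indep_vars_def)

lemma Z_integrable: "integrable M (Z t)"
  by (rule square_integrable_imp_integrable[OF Z_measurable Z_square_integrable])

lemma expectation_Z_cong:
  fixes h :: "real \<Rightarrow> real"
  assumes "h \<in> borel_measurable borel"
  shows "expectation (\<lambda>x. h (Z s x)) = expectation (\<lambda>x. h (Z t x))"
  using integral_distr[OF Z_measurable assms, of s] integral_distr[OF Z_measurable assms, of t]
    Z_ident[of s t] by simp

text \<open>The news impact with its centring constant frozen at time 0. This makes it a single
  function of a real argument, as a time-independent coding requires; identical distribution shows
  that nothing changes.\<close>

definition shock :: "real \<Rightarrow> real" where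
  "shock u = \<theta> * u + \<gamma> * (\<bar>u\<bar> - expectation (\<lambda>y. \<bar>Z 0 y\<bar>))"

lemma shock_measurable [measurable]: "shock \<in> borel_measurable borel"
  unfolding shock_def by measurable

lemma news_impact_eq_shock: "news_impact M \<theta> \<gamma> (Z t) x = shock (Z t x)"
  using expectation_Z_cong[of abs t 0] by (simp add: news_impact_def shock_def)

lemma shock_centered: "expectation (\<lambda>x. shock (Z t x)) = 0"
proof -
  have "expectation (\<lambda>x. shock (Z t x)) =
      \<theta> * expectation (Z t) + \<gamma> * (expectation (\<lambda>x. \<bar>Z t x\<bar>) - expectation (\<lambda>y. \<bar>Z 0 y\<bar>))"
    unfolding shock_def using Z_integrable by (simp add: prob_space)
  then show ?thesis
    using expectation_Z_cong[of abs t 0] by (simp add: Z_mean)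
qed

lemma shock_square_integrable: "integrable M (\<lambda>x. (shock (Z t x))\<^sup>2)"
proof -
  let ?m = "expectation (\<lambda>y. \<bar>Z 0 y\<bar>)"
  have bound: "(shock u)\<^sup>2 \<le> 3 * (\<theta>\<^sup>2 * u\<^sup>2 + \<gamma>\<^sup>2 * u\<^sup>2 + \<gamma>\<^sup>2 * ?m\<^sup>2)" for u
  proof -
    \<comment> \<open>The difference of the two sides is the sum of the squares of a - b, b + c and
      a + c.\<close>
    have "(a + b - c)\<^sup>2 \<le> 3 * (a\<^sup>2 + b\<^sup>2 + c\<^sup>2)" for a b c :: real
      using sum_squares_ge_zero[of "a - b" "b + c"] zero_le_power2[of "a + c"]
      by (simp add: power2_eq_square algebra_simps)
    from this[of "\<theta> * u" "\<gamma> * \<bar>u\<bar>" "\<gamma> * ?m"] show ?thesis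
      by (simp add: shock_def power_mult_distrib algebra_simps)
  qed
  show ?thesis
  proof (rule Bochner_Integration.integrable_bound)
    show "integrable M (\<lambda>x. 3 * (\<theta>\<^sup>2 * (Z t x)\<^sup>2 + \<gamma>\<^sup>2 * (Z t x)\<^sup>2 + \<gamma>\<^sup>2 * ?m\<^sup>2))"
      using Z_square_integrable by (intro integrable_mult_right Bochner_Integration.integrable_add) auto
    show "AE x in M. norm ((shock (Z t x))\<^sup>2) \<le>
        norm (3 * (\<theta>\<^sup>2 * (Z t x)\<^sup>2 + \<gamma>\<^sup>2 * (Z t x)\<^sup>2 + \<gamma>\<^sup>2 * ?m\<^sup>2))"
      using bound by (intro AE_I2) (simp add: order_trans[OF _ abs_ge_self])
  qed measurable
qed

text \<open>The joint premises of almost sure convergence and of square integrability. Identical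
  distribution reduces the variances to a fixed multiple of the squares of
  \<open>lam\<close>.\<close>

lemma shock_series:
  assumes "d < 1 / 2"
  shows "indep_vars (\<lambda>_. borel) (\<lambda>k x. lam k * shock (Z (t - 1 - int k) x)) UNIV"
    and "integrable M (\<lambda>x. (lam k * shock (Z (t - 1 - int k) x))\<^sup>2)"
    and "expectation (\<lambda>x. lam k * shock (Z (t - 1 - int k) x)) = 0"
    and "summable (\<lambda>k. expectation (\<lambda>x. (lam k * shock (Z (t - 1 - int k) x))\<^sup>2))"
proof -
  have "indep_vars (\<lambda>_. borel) (\<lambda>k. Z (t - 1 - int k)) UNIV"
    by (rule indep_vars_inj_reindex[OF Z_indep]) (auto simp: inj_on_def)
  then show "indep_vars (\<lambda>_. borel) (\<lambda>k x. lam k * shock (Z (t - 1 - int k) x)) UNIV"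
    by (rule indep_vars_compose2[where Y = "\<lambda>k u. lam k * shock u"]) measurable
  show "integrable M (\<lambda>x. (lam k * shock (Z (t - 1 - int k) x))\<^sup>2)"
    using shock_square_integrable by (simp add: power_mult_distrib)
  show "expectation (\<lambda>x. lam k * shock (Z (t - 1 - int k) x)) = 0"
    by (simp add: shock_centered)
  have "expectation (\<lambda>x. (lam k * shock (Z (t - 1 - int k) x))\<^sup>2) =
      (lam k)\<^sup>2 * expectation (\<lambda>x. (shock (Z 0 x))\<^sup>2)" for k
    using expectation_Z_cong[of "\<lambda>u. (shock u)\<^sup>2" "t - 1 - int k" 0]
    by (simp add: power_mult_distrib)
  then show "summable (\<lambda>k. expectation (\<lambda>x. (lam k * shock (Z (t - 1 - int k) x))\<^sup>2))"
    using summable_lam_square[OF assms] by (simp add: summable_mult2)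
qed

text \<open>The time-0 value read off a path; the index \<open>- 1 - int k\<close> reflects that
  volatility depends on strictly past innovations. As \<open>suminf\<close> is total, the function
  is defined and measurable on all paths, including those where the series diverges.\<close>

definition log_vol :: "(int \<Rightarrow> real) \<Rightarrow> real" where
  "log_vol z = \<omega> + (\<Sum>k. lam k * shock (z (- 1 - int k)))"

lemma log_vol_measurable [measurable]: "log_vol \<in> borel_measurable (PiM UNIV (\<lambda>_. borel))"
  unfolding log_vol_def by measurable

lemma log_vol_path_shift:
  "log_vol (path_shift t (\<lambda>s. Z s x)) = \<omega> + (\<Sum>k. lam k * shock (Z (t - 1 - int k) x))"
  by (simp add: log_vol_def path_shift_apply algebra_simps)

text \<open>Almost sure convergence discharges the premise under which the model determines the
  volatility. Summability is kept in the conclusion because the value of \<open>suminf\<close> alone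
  would not express convergence.\<close>

lemma AE_log_volatility:
  assumes "d < 1 / 2"
  shows "AE x in M. summable (\<lambda>k. lam k * shock (Z (t - 1 - int k) x)) \<and>
    ln ((\<sigma> t x)\<^sup>2) = log_vol (path_shift t (\<lambda>s. Z s x))"
proof -
  have "AE x in M. summable (\<lambda>k. lam k * shock (Z (t - 1 - int k) x))"
    by (rule AE_summable_indep) (rule shock_series[OF assms])+
  then show ?thesis
    using log_volatility[of t]
    by eventually_elim (simp add: news_impact_eq_shock log_vol_path_shift)
qed

lemma log_volatility_square_integrable:
  assumes "d < 1 / 2"
  shows "integrable M (\<lambda>x. (ln ((\<sigma> t x)\<^sup>2))\<^sup>2)"
proof -
  note [measurable] = \<sigma>_measurable
  define L where "L x = (\<Sum>k. lam k * shock (Z (t - 1 - int k) x))" for x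
  have [measurable]: "L \<in> borel_measurable M"
    unfolding L_def by measurable
  have L_sq: "integrable M (\<lambda>x. (L x)\<^sup>2)"
    unfolding L_def by (rule integrable_square_suminf_indep) (rule shock_series[OF assms])+
  have "integrable M (\<lambda>x. (\<omega> + L x)\<^sup>2)"
    using square_integrable_imp_integrable[OF _ L_sq] L_sq
    by (simp add: power2_sum)
  then show ?thesis
  proof (rule integrable_cong_AE_imp)
    show "AE x in M. (\<omega> + L x)\<^sup>2 = (ln ((\<sigma> t x)\<^sup>2))\<^sup>2"
      using AE_log_volatility[OF assms, of t]
      by eventually_elim (simp add: log_vol_path_shift L_def)
  qed measurable
qed

end

section \<open>Stationarity and ergodicity of the log-volatility, the process and the squared
  volatility\<close>

theorem corollary1:
  fixes M :: "'a measure"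
    and p q :: nat
    and \<alpha> \<beta> :: "nat \<Rightarrow> real"
    and d \<omega> \<theta> \<gamma> :: real
    and lam :: "nat \<Rightarrow> real"
    and Z \<sigma> X :: "int \<Rightarrow> 'a \<Rightarrow> real"
  assumes "fiegarch M p q \<alpha> \<beta> d \<omega> \<theta> \<gamma> lam Z \<sigma> X"
    and "d < 1 / 2"
  shows "weakly_stationary M (\<lambda>t x. ln ((\<sigma> t x)\<^sup>2)) \<and>
    strictly_stationary M (\<lambda>t x. ln ((\<sigma> t x)\<^sup>2)) \<and>
    ergodic_process M (\<lambda>t x. ln ((\<sigma> t x)\<^sup>2)) \<and>
    (\<forall>t. AE x in M.
      (\<lambda>k. lam k * news_impact M \<theta> \<gamma> (Z (t - 1 - int k)) x) sums (ln ((\<sigma> t x)\<^sup>2) - \<omega>)) \<and>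
    strictly_stationary M X \<and> ergodic_process M X \<and>
    strictly_stationary M (\<lambda>t x. (\<sigma> t x)\<^sup>2) \<and> ergodic_process M (\<lambda>t x. (\<sigma> t x)\<^sup>2)"
proof -
  interpret fiegarch M p q \<alpha> \<beta> d \<omega> \<theta> \<gamma> lam Z \<sigma> X by fact
  note [measurable] = \<sigma>_measurable
  have X_measurable [measurable]: "X t \<in> borel_measurable M" for t
    by (subst measurable_cong[OF X_eq]) auto
  have log_vol_AE: "AE x in M. ln ((\<sigma> t x)\<^sup>2) = log_vol (path_shift t (\<lambda>s. Z s x))" for t
    using AE_log_volatility[OF assms(2), of t] by eventually_elim simp
  have \<sigma>_AE: "AE x in M. (\<sigma> t x)\<^sup>2 = exp (log_vol (path_shift t (\<lambda>s. Z s x)))" for t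
    using log_vol_AE[of t] AE_space
  proof eventually_elim
    case (elim x)
    then show ?case using \<sigma>_pos[of x t] by (simp flip: elim(1))
  qed
  \<comment> \<open>Positivity of \<open>\<sigma>\<close> makes half the log-volatility equal to
    \<open>ln (\<sigma> t x)\<close>, so the exponential recovers \<open>\<sigma>\<close> without
    sign ambiguity. The innovation \<open>Z t x\<close> is coordinate 0 of the path shifted by
    t.\<close>
  have X_AE: "AE x in M. X t x =
      exp (log_vol (path_shift t (\<lambda>s. Z s x)) / 2) * path_shift t (\<lambda>s. Z s x) 0" for t
    using log_vol_AE[of t] AE_space
  proof eventually_elim
    case (elim x)
    then have "exp (log_vol (path_shift t (\<lambda>s. Z s x)) / 2) = \<sigma> t x"
      using \<sigma>_pos[of x t] by (simp add: ln_realpow flip: elim(1))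
    then show ?case
      using X_eq elim(2) by (simp add: path_shift_apply)
  qed
  have log_coding: "strictly_stationary M (\<lambda>t x. ln ((\<sigma> t x)\<^sup>2))" "ergodic_process M (\<lambda>t x. ln ((\<sigma> t x)\<^sup>2))"
    by (rule coding_strictly_stationary[OF Z_indep Z_ident _ _ log_vol_AE]
        coding_ergodic[OF Z_indep Z_ident _ _ log_vol_AE]; measurable)+
  have "strictly_stationary M (\<lambda>t x. (\<sigma> t x)\<^sup>2)" "ergodic_process M (\<lambda>t x. (\<sigma> t x)\<^sup>2)"
    by (rule coding_strictly_stationary[OF Z_indep Z_ident _ _ \<sigma>_AE]
        coding_ergodic[OF Z_indep Z_ident _ _ \<sigma>_AE]; measurable)+
  moreover have "strictly_stationary M X" "ergodic_process M X"
    \<comment> \<open>The path enters twice, through \<open>log_vol\<close> and through coordinate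
      0, so the coding function is given explicitly.\<close>
    by (rule coding_strictly_stationary[where f = "\<lambda>z. exp (log_vol z / 2) * z 0", OF Z_indep Z_ident _ _ X_AE]
        coding_ergodic[where f = "\<lambda>z. exp (log_vol z / 2) * z 0", OF Z_indep Z_ident _ _ X_AE]; measurable)+
  moreover have "weakly_stationary M (\<lambda>t x. ln ((\<sigma> t x)\<^sup>2))"
    using log_coding(1) log_volatility_square_integrable[OF assms(2)]
    by (rule strictly_stationary_imp_weakly_stationary)
  moreover have "AE x in M. (\<lambda>k. lam k * news_impact M \<theta> \<gamma> (Z (t - 1 - int k)) x)
      sums (ln ((\<sigma> t x)\<^sup>2) - \<omega>)" for t
    using AE_log_volatility[OF assms(2), of t]
    by eventually_elim (simp add: news_impact_eq_shock log_vol_path_shift summable_sums)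
  ultimately show ?thesis
    using log_coding by blast
qed

end
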